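(* Let $m\ge 2$. In $U(\mathfrak{so}_{2m})$, with $H=\sqrt{-1}A_{2m,2m-1}$ and $X_i=A_{2m-1,i}+\sqrt{-1}A_{2m,i}$ for $1\le i\le 2m-2$, the Pfaffian element satisfies $$\sqrt{-1}\,\mathbb{PF}_{2m}=(H-m+1)\,\mathbb{PF}_{2m-2}-\sum_{i=1}^{2m-2}X_i\,[A_{2m-1,i},\mathbb{PF}_{2m-2}].$$
   Context: $E_{i,j}$ are the matrix units, $A_{j,i}=E_{j,i}-E_{i,j}$, and $\mathfrak{so}_{2m}$ is the complex Lie algebra of skew-symmetric $2m\times 2m$ matrices, spanned by the $A_{j,i}$. $\mathfrak{so}_{2m-2}$ is the subalgebra spanned by $A_{j,i}$ with $i,j\le 2m-2$, so $U(\mathfrak{so}_{2m-2})\subset U(\mathfrak{so}_{2m})$. For distinct positive integers $i_1,\dots,i_{2k}$ define inductively, in the enveloping algebra, $\mathrm{Pf}_2(i_2,i_1)=A_{i_2,i_1}$ and $$\mathrm{Pf}_{2k}(i_{2k},i_{2k-1},\dots,i_1)=\sum_{j=1}^{2k-1}(-1)^{j+1}A_{i_{2k},i_j}\,\mathrm{Pf}_{2k-2}(i_{2k-1},\dots,\widehat{i_j},\dots,i_1),$$ where the hat means omission, and put $\mathbb{PF}_{2k}=\mathrm{Pf}_{2k}(2k,2k-1,\dots,1)$. *)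

theory Defs
  imports
    "HOL.Complex"
    "HOL-Library.Poly_Mapping"
    "HOL-Algebra.QuotRing"
    "HOL-Algebra.Module"
    "Jordan_Normal_Form.Matrix"
begin

section \<open>The free algebra on a set\<close>

datatype 'a word = Word (letters: "'a list")

instantiation word :: (type) monoid_add
begin

definition "0 = Word []"

definition "v + w = Word (letters v @ letters w)"

instance
  by standard (simp_all add: zero_word_def plus_word_def)

end

text \<open>
  Addition of words is concatenation, so the convolution product of \<^typ>\<open>'a word \<Rightarrow>\<^sub>0 complex\<close>
  makes it the free associative unital complex algebra on \<^typ>\<open>'a\<close>. Only words with letters in
  \<open>S\<close> are allowed below, which gives the free algebra on the set \<open>S\<close>.
\<close>

definition free_algebra :: "'a set \<Rightarrow> ('a word \<Rightarrow>\<^sub>0 complex) ring"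
  where "free_algebra S =
    \<lparr>carrier = {p. \<forall>w \<in> Poly_Mapping.keys p. set (letters w) \<subseteq> S},
     monoid.mult = (*), one = 1, ring.zero = 0, add = (+)\<rparr>"

definition letter :: "'a \<Rightarrow> 'a word \<Rightarrow>\<^sub>0 complex"
  where "letter x = Poly_Mapping.single (Word [x]) 1"

definition scalar :: "complex \<Rightarrow> 'a word \<Rightarrow>\<^sub>0 complex"
  where "scalar c = Poly_Mapping.single 0 c"

section \<open>The universal enveloping algebra of a matrix Lie algebra\<close>

text \<open>
  \<open>L\<close> is meant to be a complex subspace of the \<open>n \<times> n\<close> matrices, closed under the commutator.
  The first two families of relators make the free algebra on the set \<open>L\<close> into the tensor algebra
  of the vector space \<open>L\<close>; the third one identifies commutators with Lie brackets.
\<close>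

definition lie_relators :: "complex mat set \<Rightarrow> (complex mat word \<Rightarrow>\<^sub>0 complex) set"
  where "lie_relators L =
    {letter (x + y) - (letter x + letter y) | x y. x \<in> L \<and> y \<in> L} \<union>
    {letter (c \<cdot>\<^sub>m x) - scalar c * letter x | c x. x \<in> L} \<union>
    {letter x * letter y - letter y * letter x - letter (x * y - y * x) | x y. x \<in> L \<and> y \<in> L}"

text \<open>Ideals of \<^theory>\<open>HOL-Algebra.Ideal\<close> are two-sided.\<close>

definition lie_ideal :: "complex mat set \<Rightarrow> (complex mat word \<Rightarrow>\<^sub>0 complex) set"
  where "lie_ideal L = genideal (free_algebra L) (lie_relators L)"

text \<open>
  The record type \<^typ>\<open>('a, 'b) module\<close> serves to store the multiplication by complex scalars
  beside the ring operations. It is multiplication by the class of the constant \<open>c\<close>.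
\<close>

definition enveloping_algebra ::
    "complex mat set \<Rightarrow> (complex, (complex mat word \<Rightarrow>\<^sub>0 complex) set) module"
  where "enveloping_algebra L =
    ring.extend (free_algebra L Quot lie_ideal L)
      (module.fields (\<lambda>c X.
        (lie_ideal L +>\<^bsub>free_algebra L\<^esub> scalar c) \<otimes>\<^bsub>free_algebra L Quot lie_ideal L\<^esub> X))"

definition env :: "complex mat set \<Rightarrow> complex mat \<Rightarrow> (complex mat word \<Rightarrow>\<^sub>0 complex) set"
  where "env L x = lie_ideal L +>\<^bsub>free_algebra L\<^esub> letter x"

section \<open>The orthogonal Lie algebra and its Pfaffians\<close>

definition so_algebra :: "nat \<Rightarrow> complex mat set"
  where "so_algebra n = {M \<in> carrier_mat n n. transpose_mat M = - M}"

text \<open>Rows and columns of \<^typ>\<open>'a mat\<close> are numbered from 0, the indices \<open>i\<close>, \<open>j\<close> here from 1.\<close>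

definition mat_unit :: "nat \<Rightarrow> nat \<Rightarrow> nat \<Rightarrow> complex mat"
  where "mat_unit n i j = mat n n (\<lambda>(r, c). if Suc r = i \<and> Suc c = j then 1 else 0)"

definition skew_unit :: "nat \<Rightarrow> nat \<Rightarrow> nat \<Rightarrow> complex mat"
  where "skew_unit n j i = mat_unit n j i - mat_unit n i j"

text \<open>\<open>so_gen n j i\<close> is the element \<open>A\<^sub>j\<^sub>,\<^sub>i\<close> of the enveloping algebra.\<close>

definition so_gen :: "nat \<Rightarrow> nat \<Rightarrow> nat \<Rightarrow> (complex mat word \<Rightarrow>\<^sub>0 complex) set"
  where "so_gen n j i = env (so_algebra n) (skew_unit n j i)"

text \<open>The sequence \<open>i 1, i 2, \<dots>\<close> with the entry \<open>i j\<close> left out:\<close>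

definition omit :: "nat \<Rightarrow> (nat \<Rightarrow> nat) \<Rightarrow> nat \<Rightarrow> nat"
  where "omit j i = (\<lambda>r. if r < j then i r else i (Suc r))"

text \<open>
  \<open>Pf n k i\<close> is \<open>Pf\<^sub>2\<^sub>k(i\<^sub>2\<^sub>k, \<dots>, i\<^sub>1)\<close> in \<open>U(so\<^sub>n)\<close>, where \<open>i\<^sub>j = i j\<close> for \<open>1 \<le> j \<le> 2k\<close>; while the
  other values of \<open>i\<close> are irrelevant. The recursion starts at \<open>k = 1\<close>, and \<open>k = 0\<close> is a dummy case.
\<close>

fun Pf :: "nat \<Rightarrow> nat \<Rightarrow> (nat \<Rightarrow> nat) \<Rightarrow> (complex mat word \<Rightarrow>\<^sub>0 complex) set"
  where
    "Pf n 0 i = \<one>\<^bsub>enveloping_algebra (so_algebra n)\<^esub>"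
  | "Pf n (Suc 0) i = so_gen n (i 2) (i 1)"
  | "Pf n (Suc (Suc k)) i =
      (let U = enveloping_algebra (so_algebra n); K = Suc (Suc k) in
        \<Oplus>\<^bsub>U\<^esub>j \<in> {1..2 * K - 1}.
          ((- 1) ^ (j + 1)) \<odot>\<^bsub>U\<^esub> (so_gen n (i (2 * K)) (i j) \<otimes>\<^bsub>U\<^esub> Pf n (Suc k) (omit j i)))"

text \<open>
  \<open>PF n k\<close> is \<open>Pf\<^sub>2\<^sub>k(2k, \<dots>, 1)\<close> in \<open>U(so\<^sub>n)\<close>. For \<open>2k \<le> n\<close> this is the image of the element of
  \<open>U(so\<^sub>2\<^sub>k)\<close> given by the same formula, since the inclusion \<open>U(so\<^sub>2\<^sub>k) \<subseteq> U(so\<^sub>n)\<close> maps generators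
  \<open>A\<^sub>j\<^sub>,\<^sub>i\<close> to generators \<open>A\<^sub>j\<^sub>,\<^sub>i\<close>.
\<close>

definition PF :: "nat \<Rightarrow> nat \<Rightarrow> (complex mat word \<Rightarrow>\<^sub>0 complex) set"
  where "PF n k = Pf n k (\<lambda>j. j)"

definition commutator :: "('a, 'b) ring_scheme \<Rightarrow> 'a \<Rightarrow> 'a \<Rightarrow> 'a"
  where "commutator R x y = x \<otimes>\<^bsub>R\<^esub> y \<ominus>\<^bsub>R\<^esub> y \<otimes>\<^bsub>R\<^esub> x"

end

(*
  All indices below are taken from increasing sequences, so a Pfaffian only depends on the set S of
  its indices, and P(S) is expanded along the row of Max S. If p exceeds all elements of S and j is
  in S, then [A_{p,j}, P(S)] is P with j replaced by p, that is, up to sign, P(S - j + p). Expanding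
  P(S + p + q) along its top row q > p thus gives
    P(S + p + q) = A_{q,p} P(S) - sum_{j in S} A_{q,j} [A_{p,j}, P(S)].
  The terms A_{p,j} [A_{p,j}, P(S)], expanded along the row p and antisymmetrized, add up to
  sums of A_{l,j} P(S - j - l), which count every perfect matching of S once for each of its pairs;
  their total is - |S|/2 P(S). This is where the shift - m + 1 comes from.
*)
theory Submission
  imports Defs "HOL-Algebra.Multiplicative_Group"
begin

section \<open>Pfaffians over a noncommutative ring\<close>

text \<open>The entries do not commute, so the antisymmetry of a Pfaffian in its indices cannot be
  read off from a recursion that only knows the top row. What survives is that generators without a
  common index commute, and the exchange of two rows rests on this. The shape of X_i comes from
  completing a sum: sqrt(-1) times the expansion yields only the summands sqrt(-1) A_{2m,i}.
  Supplementing them by A_{2m-1,i} changes the right side by (m-1) PF_{2m-2}, which the constant in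
  H - m + 1 takes back. The enveloping algebra is a ring on a carrier that depends on m, whereas a
  type depends on no parameter. The identity is therefore proved in a single type, a product over
  all rings on the underlying type, and then projected to one component. In an increasing sequence
  exactly j - 1 entries lie below the j-th, so the sign (-1)^(j+1) of the recursion becomes
  \<open>rank_sign\<close>, which no longer mentions positions.\<close>

definition rank_sign :: "nat \<Rightarrow> nat set \<Rightarrow> 'a::ring_1" where
  "rank_sign l S = (- 1) ^ card {s \<in> S. s < l}"

lemma rank_sign_cases: "rank_sign l S = (1 :: 'a::ring_1) \<or> rank_sign l S = (- 1 :: 'a)"
  unfolding rank_sign_def using minus_one_power_iff by metis

lemma rank_sign_remove_less:
  assumes "finite S" "r \<in> S" "r < l"
  shows "rank_sign l (S - {r}) = - rank_sign l S"
proof -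
  have "{s \<in> S. s < l} = insert r {s \<in> S - {r}. s < l}" using assms by auto
  then have "card {s \<in> S. s < l} = Suc (card {s \<in> S - {r}. s < l})"
    using assms by simp
  then show ?thesis unfolding rank_sign_def by simp
qed

lemma rank_sign_remove_ge:
  assumes "l \<le> r"
  shows "rank_sign l (S - {r}) = rank_sign l S"
proof -
  have "{s \<in> S - {r}. s < l} = {s \<in> S. s < l}" using assms by auto
  then show ?thesis unfolding rank_sign_def by simp
qed

lemma rank_sign_insert_ge: "l \<le> r \<Longrightarrow> rank_sign l (insert r S) = rank_sign l S"
  by (metis rank_sign_remove_ge Diff_insert_absorb insert_absorb)

lemma rank_sign_above:
  assumes "\<And>s. s \<in> S \<Longrightarrow> s < q"
  shows "rank_sign q S = (- 1) ^ card S"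
proof -
  have "{s \<in> S. s < q} = S" using assms by auto
  then show ?thesis unfolding rank_sign_def by simp
qed

lemma rank_sign_commute: "(x :: 'a::ring_1) * rank_sign l S = rank_sign l S * x"
  using rank_sign_cases[of l S, where 'a='a] by auto

text \<open>Of two elements, only the smaller one affects the rank of the other when it is removed.
  Hence exactly one of the two orders of removal costs a sign.\<close>

lemma rank_sign_swap:
  assumes "finite S" "l \<in> S" "r \<in> S" "l \<noteq> r"
  shows "rank_sign r S * rank_sign l (S - {r}) = - (rank_sign l S * rank_sign r (S - {l}) :: 'a::ring_1)"
  using assms rank_sign_cases[of l S, where 'a='a] rank_sign_cases[of r S, where 'a='a]
  by (cases "l < r") (auto simp: rank_sign_remove_less rank_sign_remove_ge)

text \<open>Moving the removal of r past that of j costs one sign, and past that of l another; the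
  two cancel.\<close>

lemma rank_sign_swap_pair:
  assumes "finite S" "j \<in> S" "l \<in> S" "r \<in> S" "j \<noteq> l" "r \<noteq> j" "r \<noteq> l"
  shows "rank_sign j S * rank_sign l S * rank_sign r (S - {j} - {l})
    = (rank_sign r S * rank_sign j (S - {r}) * rank_sign l (S - {r}) :: 'a::ring_1)"
  using assms rank_sign_cases[of l S, where 'a='a] rank_sign_cases[of r S, where 'a='a]
    rank_sign_cases[of j S, where 'a='a]
  by (cases "l < r"; cases "j < r") (auto simp: rank_sign_remove_less rank_sign_remove_ge)

text \<open>\<open>set_pf A k S\<close> is meant for \<open>card S = 2 * k\<close>.\<close>

fun set_pf :: "(nat \<Rightarrow> nat \<Rightarrow> 'a::ring_1) \<Rightarrow> nat \<Rightarrow> nat set \<Rightarrow> 'a" where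
  "set_pf A 0 S = 1"
| "set_pf A (Suc k) S =
    (\<Sum>l\<in>S - {Max S}. rank_sign l S * (A (Max S) l * set_pf A k (S - {Max S} - {l})))"

declare set_pf.simps(2) [simp del]

lemma set_pf_insert:
  assumes "finite S" "\<And>s. s \<in> S \<Longrightarrow> s < p"
  shows "set_pf A (Suc k) (insert p S) = (\<Sum>l\<in>S. rank_sign l S * (A p l * set_pf A k (S - {l})))"
proof -
  have "Max (insert p S) = p"
    using assms by (intro Max_eqI) (auto intro: less_imp_le)
  moreover have "insert p S - {p} = S" using assms(2) by blast
  ultimately show ?thesis
    by (simp add: set_pf.simps(2)) (rule sum.cong, auto simp: rank_sign_insert_ge assms(2) less_imp_le)
qed

lemma commuting_left_commute:
  fixes x y z :: "'a::semigroup_mult"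
  shows "x * y = y * x \<Longrightarrow> x * (y * z) = y * (x * z)"
  by (metis mult.assoc)

text \<open>Together with \<open>skew\<close>, the relations give every bracket of two generators
  within \<open>I\<close> that share at most one index. Indices are confined to \<open>I\<close>
  because a matrix unit with an index out of range is zero, and then \<open>bracket\<close> may
  fail.\<close>

locale skew_generators =
  fixes A :: "nat \<Rightarrow> nat \<Rightarrow> 'a::ring_1" and I :: "nat set"
  assumes finite_I: "finite I"
    and skew: "a \<in> I \<Longrightarrow> b \<in> I \<Longrightarrow> A b a = - A a b"
    and disjoint_commute: "\<lbrakk>{a, b, c, d} \<subseteq> I; a \<notin> {c, d}; b \<notin> {c, d}\<rbrakk>
      \<Longrightarrow> A a b * A c d = A c d * A a b"
    and bracket: "\<lbrakk>a \<in> I; b \<in> I; c \<in> I; a \<noteq> b; b \<noteq> c; a \<noteq> c\<rbrakk>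
      \<Longrightarrow> A a b * A b c - A b c * A a b = A a c"
begin

lemma finite_sub: "S \<subseteq> I \<Longrightarrow> finite S"
  using finite_I finite_subset by blast

abbreviation (input) P where "P \<equiv> set_pf A"

lemma rank_sign_left_commute:
  "A a b * (rank_sign l S * y) = rank_sign l S * (A a b * y)" "P k T * (rank_sign l S * y) = rank_sign l S * (P k T * y)"
  by (metis rank_sign_commute mult.assoc)+

section \<open>Exchange of rows and brackets with a generator\<close>

lemma commute_set_pf:
  assumes "S \<subseteq> I" "a \<in> I" "b \<in> I" "a \<notin> S" "b \<notin> S"
  shows "A a b * P k S = P k S * A a b"
  using assms
proof (induction k arbitrary: S)
  case (Suc k)
  have "A a b * (rank_sign l S * (A (Max S) l * P k (S - {Max S} - {l})))
      = (rank_sign l S * (A (Max S) l * P k (S - {Max S} - {l}))) * A a b"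
    if l: "l \<in> S - {Max S}" for l
  proof -
    have "Max S \<in> S" using l finite_sub[OF Suc.prems(1)] Max_in by blast
    then have c: "A a b * A (Max S) l = A (Max S) l * A a b"
      using l Suc.prems by (intro disjoint_commute) auto
    have "A a b * P k (S - {Max S} - {l}) = P k (S - {Max S} - {l}) * A a b"
      using Suc.prems by (intro Suc.IH) auto
    then have "A a b * (A (Max S) l * P k (S - {Max S} - {l}))
        = A (Max S) l * P k (S - {Max S} - {l}) * A a b"
      using c by (metis mult.assoc)
    then show ?thesis by (simp add: rank_sign_left_commute mult.assoc)
  qed
  then show ?case
    unfolding set_pf.simps(2) sum_distrib_left sum_distrib_right by (intro sum.cong) auto
qed simp

text \<open>This stands in for antisymmetry under exchange of the two top indices. Expanding twice
  leaves products of an entry of row p, an entry of row q and a common cofactor. The four indices of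
  the two entries are distinct, so the entries commute, and interchanging their columns produces the
  minus sign.\<close>

lemma second_row_expansion:
  assumes T: "T \<subseteq> I" "card T = 2 * k" and pq: "p \<in> I" "q \<in> I" "q < p"
    and below: "\<And>s. s \<in> T \<Longrightarrow> s < q"
  shows "P (Suc k) (insert p (insert q T))
    = A p q * P k T - (\<Sum>l\<in>T. rank_sign l T * (A q l * P k (insert p (T - {l}))))"
proof -
  have fin: "finite T" using T(1) by (rule finite_sub)
  have q: "q \<notin> T" using below by auto
  have below': "s < p" if "s \<in> T" for s using below[OF that] pq(3) by simp
  have "P (Suc k) (insert p (insert q T))
      = (\<Sum>l\<in>insert q T. rank_sign l (insert q T) * (A p l * P k (insert q T - {l})))"
    using fin below' pq(3) by (intro set_pf_insert) auto
  also have "\<dots> = rank_sign q (insert q T) * (A p q * P k (insert q T - {q}))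
      + (\<Sum>l\<in>T. rank_sign l (insert q T) * (A p l * P k (insert q T - {l})))"
    using fin q by simp
  \<comment> \<open>All 2k elements of T lie below q, so the sign is +1.\<close>
  also have "rank_sign q (insert q T) * (A p q * P k (insert q T - {q})) = A p q * P k T"
    using q below T(2) by (simp add: rank_sign_insert_ge rank_sign_above)
  also have "(\<Sum>l\<in>T. rank_sign l (insert q T) * (A p l * P k (insert q T - {l})))
      = (\<Sum>l\<in>T. rank_sign l T * (A p l * P k (insert q (T - {l}))))"
    using q below by (intro sum.cong) (auto simp: rank_sign_insert_ge less_imp_le insert_Diff_if)
  also have "\<dots> = - (\<Sum>l\<in>T. rank_sign l T * (A q l * P k (insert p (T - {l}))))"
  proof (cases k)
    case 0
    then show ?thesis using T(2) fin by simp
  next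
    case (Suc k')
    let ?f = "\<lambda>a b l r. rank_sign l T * (rank_sign r (T - {l}) * (A a l * (A b r * P k' (T - {l} - {r}))))"
    have expand: "(\<Sum>l\<in>T. rank_sign l T * (A a l * P k (insert b (T - {l}))))
        = (\<Sum>l\<in>T. \<Sum>r\<in>T - {l}. ?f a b l r)" if "\<And>s. s \<in> T \<Longrightarrow> s < b" for a b
    proof (intro sum.cong refl)
      fix l
      have "P k (insert b (T - {l})) = (\<Sum>r\<in>T - {l}. rank_sign r (T - {l}) * (A b r * P k' (T - {l} - {r})))"
        unfolding Suc using fin that by (intro set_pf_insert) auto
      then show "rank_sign l T * (A a l * P k (insert b (T - {l}))) = (\<Sum>r\<in>T - {l}. ?f a b l r)"
        by (simp add: sum_distrib_left rank_sign_left_commute)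
    qed
    have "(\<Sum>l\<in>T. \<Sum>r\<in>T - {l}. ?f p q l r) = (\<Sum>l\<in>T. \<Sum>r\<in>{r \<in> T. l \<noteq> r}. ?f p q l r)"
      by (intro sum.cong) auto
    also have "\<dots> = (\<Sum>r\<in>T. \<Sum>l\<in>{l \<in> T. l \<noteq> r}. ?f p q l r)"
      using fin by (rule sum.swap_restrict) (rule fin)
    also have "\<dots> = (\<Sum>r\<in>T. \<Sum>l\<in>T - {r}. - ?f q p r l)"
    proof (intro sum.cong refl)
      fix r l assume r: "r \<in> T" and l: "l \<in> T - {r}"
      have "A p l * (A q r * P k' (T - {r} - {l})) = A q r * (A p l * P k' (T - {r} - {l}))"
        using r l T(1) pq below[of r] below[of l] below'[of r] below'[of l]
        by (intro commuting_left_commute disjoint_commute) auto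
      moreover have "T - {l} - {r} = T - {r} - {l}" by auto
      ultimately have "?f p q l r
          = (rank_sign l T * rank_sign r (T - {l})) * (A q r * (A p l * P k' (T - {r} - {l})))"
        by (simp add: mult.assoc)
      also have "\<dots> = - (rank_sign r T * rank_sign l (T - {r})) * (A q r * (A p l * P k' (T - {r} - {l})))"
        using rank_sign_swap[of T r l, where 'a='a] fin r l by simp
      finally show "?f p q l r = - ?f q p r l" by (simp add: mult.assoc)
    qed auto
    finally show ?thesis
      using expand[of q p] expand[of p q] below below' by (simp add: sum_negf)
  qed
  finally show ?thesis by simp
qed

text \<open>The bracket is a derivation that substitutes p for j. If r entries lie below j, moving p
  from that place to the top passes the 2k - 1 - r entries above j, which accounts for the factor
  \<open>- rank_sign j S\<close>. The induction expands along q, the maximum of S, and separates the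
  case where q itself is replaced.\<close>

lemma bracket_set_pf:
  assumes "S \<subseteq> I" "card S = 2 * k" "p \<in> I" "j \<in> S"
    and "\<And>s. s \<in> S \<Longrightarrow> s < p"
  shows "A p j * P k S - P k S * A p j = - (rank_sign j S * P k (insert p (S - {j})))"
  using assms
proof (induction k arbitrary: S)
  case 0
  then show ?case using finite_sub[of S] by simp
next
  case (Suc k)
  define q T where "q = Max S" and "T = S - {q}"
  have fin: "finite S" "finite T" using finite_sub[OF Suc.prems(1)] by (auto simp: T_def)
  have q: "q \<in> S" "q \<in> I" "q < p"
    using Max_in[OF fin(1)] Suc.prems by (auto simp: q_def)
  have below: "s < q" if "s \<in> T" for s
    using that Max_ge[OF fin(1), of s] by (auto simp: T_def q_def le_less)
  have below': "s < p" if "s \<in> T" for s using below[OF that] q(3) by simp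
  have S: "S = insert q T" "q \<notin> T" using q by (auto simp: T_def)
  have T: "T \<subseteq> I" "card T = 2 * k + 1" using Suc.prems(1,2) S fin by auto
  have sumS: "P (Suc k) S = (\<Sum>l\<in>T. rank_sign l T * (A q l * P k (T - {l})))"
    unfolding S(1) using fin below by (intro set_pf_insert) auto
  show ?case
  proof (cases "j = q")
    case True
    have "A p q * (rank_sign l T * (A q l * P k (T - {l}))) - (rank_sign l T * (A q l * P k (T - {l}))) * A p q
        = rank_sign l T * (A p l * P k (T - {l}))" if l: "l \<in> T" for l
    proof -
      have 1: "A p q * P k (T - {l}) = P k (T - {l}) * A p q"
        using T(1) Suc.prems(3) q(2,3) below' S(2) by (intro commute_set_pf) auto
      have 2: "A p l = A p q * A q l - A q l * A p q"
        using bracket[of p q l] Suc.prems(3) q T(1) l below[OF l] by auto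
      show ?thesis
        unfolding 2 using 1 by (simp add: rank_sign_left_commute algebra_simps)
    qed
    then have "A p q * P (Suc k) S - P (Suc k) S * A p q
        = (\<Sum>l\<in>T. rank_sign l T * (A p l * P k (T - {l})))"
      unfolding sumS sum_distrib_left sum_distrib_right sum_subtractf[symmetric]
      by (intro sum.cong) auto
    also have "\<dots> = P (Suc k) (insert p T)"
      using fin below' by (intro set_pf_insert[symmetric]) auto
    \<comment> \<open>T has the odd number 2k + 1 of elements, all below q, so
      \<open>rank_sign q S\<close> is -1 and cancels the outer minus.\<close>
    also have "\<dots> = - (rank_sign q S * P (Suc k) (insert p (S - {q})))"
      using S below T(2) by (simp add: rank_sign_insert_ge rank_sign_above)
    finally show ?thesis using True by simp
  next
    case False
    then have j: "j \<in> T" using Suc.prems(4) S by auto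
    let ?t = "\<lambda>l. rank_sign l T * (A q l * P k (T - {l}))"
    \<comment> \<open>In this one term the bracket acts on the entry A q j, giving - A p q; the
      cofactor contains neither p nor j. In all other terms it acts on the cofactor, where the
      induction hypothesis applies.\<close>
    have 0: "A p j * ?t j - ?t j * A p j = - (rank_sign j T * (A p q * P k (T - {j})))"
    proof -
      have 1: "A p j * P k (T - {j}) = P k (T - {j}) * A p j"
        using T(1) Suc.prems(3) j below' by (intro commute_set_pf) auto
      have "A j q = - A q j" using skew[of q j] q(2) T(1) j by auto
      then have 2: "A p q = - (A p j * A q j - A q j * A p j)"
        using bracket[of p j q] Suc.prems(3) q(2,3) T(1) j below[OF j] by auto
      show ?thesis unfolding 2 using 1 by (simp add: rank_sign_left_commute algebra_simps)
    qed
    have "A p j * ?t l - ?t l * A p j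
        = rank_sign j T * (rank_sign l (T - {j}) * (A q l * P k (insert p (T - {j} - {l}))))"
      if l: "l \<in> T - {j}" for l
    proof -
      have 1: "A p j * A q l = A q l * A p j"
        using T(1) Suc.prems(3) q(2,3) j l below[OF j] below[of l] below'[of l]
        by (intro disjoint_commute) auto
      have 2: "A p j * P k (T - {l}) - P k (T - {l}) * A p j
          = - (rank_sign j (T - {l}) * P k (insert p (T - {l} - {j})))"
        using T fin l j below' Suc.prems(3) by (intro Suc.IH) auto
      have "A p j * ?t l - ?t l * A p j
          = rank_sign l T * (A q l * (A p j * P k (T - {l}) - P k (T - {l}) * A p j))"
        by (simp add: rank_sign_left_commute right_diff_distrib mult.assoc
            commuting_left_commute[OF 1])
      also have "\<dots> = - (rank_sign l T * rank_sign j (T - {l})) * (A q l * P k (insert p (T - {l} - {j})))"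
        unfolding 2 by (simp add: rank_sign_left_commute mult.assoc)
      also have "\<dots> = (rank_sign j T * rank_sign l (T - {j})) * (A q l * P k (insert p (T - {l} - {j})))"
        using rank_sign_swap[of T l j, where 'a='a] fin l j by simp
      also have "T - {l} - {j} = T - {j} - {l}" by auto
      finally show ?thesis by (simp add: mult.assoc)
    qed
    note 1 = this
    have "A p j * P (Suc k) S - P (Suc k) S * A p j = (\<Sum>l\<in>T. A p j * ?t l - ?t l * A p j)"
      by (simp only: sumS sum_distrib_left sum_distrib_right sum_subtractf)
    also have "\<dots> = - (rank_sign j T * (A p q * P k (T - {j})))
          + (\<Sum>l\<in>T - {j}. rank_sign j T * (rank_sign l (T - {j}) * (A q l * P k (insert p (T - {j} - {l})))))"
      unfolding sum.remove[OF fin(2) j] 0 by (intro arg_cong2[of _ _ _ _ "(+)"] sum.cong refl 1)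
    \<comment> \<open>Once p has been inserted, q is only the second largest index, so the terms
      collected here form an expansion along the second row.\<close>
    also have "\<dots> = - (rank_sign j T * P (Suc k) (insert p (insert q (T - {j}))))"
    proof -
      have "P (Suc k) (insert p (insert q (T - {j}))) = A p q * P k (T - {j})
          - (\<Sum>l\<in>T - {j}. rank_sign l (T - {j}) * (A q l * P k (insert p (T - {j} - {l}))))"
        using T fin j Suc.prems(3) q(2,3) below by (intro second_row_expansion) auto
      then show ?thesis by (simp add: sum_distrib_left right_diff_distrib)
    qed
    also have "insert q (T - {j}) = S - {j}" using S False by auto
    also have "rank_sign j T = rank_sign j S"
      using S below[OF j] by (simp add: rank_sign_insert_ge)
    finally show ?thesis .
  qed
qed

section \<open>The sum of products from a single row\<close>

text \<open>The sum meets every perfect matching of \<open>S\<close> once for each of its \<open>k\<close> pairs.\<close>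

lemma pair_expansion:
  assumes "S \<subseteq> I" "card S = 2 * k"
  shows "(\<Sum>j\<in>S. \<Sum>l\<in>{l \<in> S. l < j}. rank_sign j S * rank_sign l S * (A j l * P (k - 1) (S - {j} - {l})))
    = - (of_nat k * P k S)"
  using assms
proof (induction k arbitrary: S)
  case 0
  then show ?case using finite_sub[of S] by simp
next
  case (Suc k)
  define q T where "q = Max S" and "T = S - {q}"
  have fin: "finite S" "finite T" using finite_sub[OF Suc.prems(1)] by (auto simp: T_def)
  have "S \<noteq> {}" using Suc.prems(2) by auto
  then have q: "q \<in> S" "q \<in> I"
    using Max_in[OF fin(1)] Suc.prems(1) by (auto simp: q_def)
  have below: "s < q" if "s \<in> T" for s
    using that Max_ge[OF fin(1), of s] by (auto simp: T_def q_def le_less)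
  have S: "S = insert q T" "q \<notin> T" using q by (auto simp: T_def)
  have T: "T \<subseteq> I" "card T = 2 * k + 1" using Suc.prems(1,2) S fin by auto
  have sumS: "P (Suc k) S = (\<Sum>l\<in>T. rank_sign l T * (A q l * P k (T - {l})))"
    unfolding S(1) using fin below by (intro set_pf_insert) auto
  let ?g = "\<lambda>j l. rank_sign j S * rank_sign l S * (A j l * P k (S - {j} - {l}))"
  have epsS: "rank_sign s S = rank_sign s T" if "s \<in> T" for s
    using S below[OF that] by (simp add: rank_sign_insert_ge)
  \<comment> \<open>Pairs containing q: T has odd cardinality, so q carries the sign -1, and what
    remains is the expansion of P(S) along row q.\<close>
  have top: "(\<Sum>l\<in>{l \<in> S. l < q}. ?g q l) = - P (Suc k) S"
  proof -
    have "{l \<in> S. l < q} = T" using S below by auto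
    moreover have "rank_sign q S = (- 1 :: 'a)"
      using S below T(2) by (simp add: rank_sign_insert_ge rank_sign_above)
    moreover have "S - {q} = T" by (simp add: T_def)
    ultimately show ?thesis
      unfolding sumS by (simp add: epsS mult.assoc sum_negf)
  qed
  \<comment> \<open>Pairs avoiding q: the cofactor still contains q and is expanded along that row.
    Its entry A q r commutes with A j l, so row q can be pulled to the front, leaving for each r the
    same pair sum over T - r, to which the induction hypothesis applies. For k = 0 the set T is a
    singleton and contains no pair.\<close>
  have rest: "(\<Sum>j\<in>T. \<Sum>l\<in>{l \<in> S. l < j}. ?g j l) = - (of_nat k * P (Suc k) S)"
  proof (cases k)
    case 0
    then obtain t where "T = {t}" using T(2) card_1_singletonE by auto
    then have "{l \<in> S. l < j} = {}" if "j \<in> T" for j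
      using S that below by auto
    then have "(\<Sum>l\<in>{l \<in> S. l < j}. ?g j l) = 0" if "j \<in> T" for j
      using that by (simp only: sum.empty)
    then show ?thesis using 0 by (simp only: sum.neutral) simp
  next
    case k: (Suc k')
    let ?h = "\<lambda>r j l. rank_sign j (T - {r}) * rank_sign l (T - {r}) * (A j l * P k' (T - {r} - {j} - {l}))"
    let ?f = "\<lambda>r j l. rank_sign r T * (A q r * ?h r j l)"
    have inner: "?g j l = (\<Sum>r\<in>{r \<in> T - {j}. l \<noteq> r}. ?f r j l)"
      if j: "j \<in> T" and l: "l \<in> T" "l < j" for j l
    proof -
      have "S - {j} - {l} = insert q (T - {j} - {l})"
        using S j l by auto
      moreover have "P k (insert q (T - {j} - {l}))
          = (\<Sum>r\<in>T - {j} - {l}. rank_sign r (T - {j} - {l}) * (A q r * P k' (T - {j} - {l} - {r})))"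
        unfolding k using fin below by (intro set_pf_insert) auto
      ultimately have "?g j l = (\<Sum>r\<in>T - {j} - {l}. rank_sign j T * rank_sign l T *
          (A j l * (rank_sign r (T - {j} - {l}) * (A q r * P k' (T - {j} - {l} - {r})))))"
        using j l by (simp add: epsS sum_distrib_left)
      also have "\<dots> = (\<Sum>r\<in>{r \<in> T - {j}. l \<noteq> r}. ?f r j l)"
      proof (intro sum.cong)
        fix r assume "r \<in> {r \<in> T - {j}. l \<noteq> r}"
        then have r: "r \<in> T" "r \<noteq> j" "r \<noteq> l" by auto
        have c: "A j l * (A q r * y) = A q r * (A j l * y)" for y
          using r j l below[OF j] below[of l] T(1) q
          by (intro commuting_left_commute disjoint_commute) auto
        have "T - {j} - {l} - {r} = T - {r} - {j} - {l}" by auto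
        then have "rank_sign j T * rank_sign l T * (A j l * (rank_sign r (T - {j} - {l}) *
            (A q r * P k' (T - {j} - {l} - {r}))))
          = (rank_sign j T * rank_sign l T * rank_sign r (T - {j} - {l})) *
            (A q r * (A j l * P k' (T - {r} - {j} - {l})))"
          by (simp add: rank_sign_left_commute mult.assoc c)
        also have "rank_sign j T * rank_sign l T * rank_sign r (T - {j} - {l})
            = (rank_sign r T * rank_sign j (T - {r}) * rank_sign l (T - {r}) :: 'a)"
          using fin r j l by (intro rank_sign_swap_pair) auto
        finally show "rank_sign j T * rank_sign l T * (A j l * (rank_sign r (T - {j} - {l}) *
            (A q r * P k' (T - {j} - {l} - {r})))) = ?f r j l"
          by (simp add: rank_sign_left_commute mult.assoc)
      qed auto
      finally show ?thesis .
    qed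
    have "(\<Sum>j\<in>T. \<Sum>l\<in>{l \<in> S. l < j}. ?g j l)
        = (\<Sum>j\<in>T. \<Sum>l\<in>{l \<in> T. l < j}. \<Sum>r\<in>{r \<in> T - {j}. l \<noteq> r}. ?f r j l)"
      using S below by (intro sum.cong inner) (auto dest: less_trans)
    also have "\<dots> = (\<Sum>j\<in>T. \<Sum>r\<in>{r \<in> T. j \<noteq> r}. \<Sum>l\<in>{l \<in> T - {r}. l < j}. ?f r j l)"
    proof (rule sum.cong)
      fix j assume "j \<in> T"
      have "(\<Sum>l\<in>{l \<in> T. l < j}. \<Sum>r\<in>{r \<in> T - {j}. l \<noteq> r}. ?f r j l)
          = (\<Sum>r\<in>T - {j}. \<Sum>l\<in>{l \<in> {l \<in> T. l < j}. l \<noteq> r}. ?f r j l)"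
        using fin by (intro sum.swap_restrict) auto
      also have "\<dots> = (\<Sum>r\<in>{r \<in> T. j \<noteq> r}. \<Sum>l\<in>{l \<in> T - {r}. l < j}. ?f r j l)"
        by (intro sum.cong) auto
      finally show "(\<Sum>l\<in>{l \<in> T. l < j}. \<Sum>r\<in>{r \<in> T - {j}. l \<noteq> r}. ?f r j l)
          = (\<Sum>r\<in>{r \<in> T. j \<noteq> r}. \<Sum>l\<in>{l \<in> T - {r}. l < j}. ?f r j l)" .
    qed simp
    also have "\<dots> = (\<Sum>r\<in>T. \<Sum>j\<in>{j \<in> T. j \<noteq> r}. \<Sum>l\<in>{l \<in> T - {r}. l < j}. ?f r j l)"
      using fin by (intro sum.swap_restrict) auto
    also have "\<dots> = (\<Sum>r\<in>T. rank_sign r T * (A q r *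
        (\<Sum>j\<in>T - {r}. \<Sum>l\<in>{l \<in> T - {r}. l < j}. ?h r j l)))"
      by (auto simp: sum_distrib_left intro!: sum.cong)
    also have "\<dots> = (\<Sum>r\<in>T. rank_sign r T * (A q r * - (of_nat k * P k (T - {r}))))"
    proof (intro sum.cong refl)
      fix r assume "r \<in> T"
      then have "(\<Sum>j\<in>T - {r}. \<Sum>l\<in>{l \<in> T - {r}. l < j}. ?h r j l) = - (of_nat k * P k (T - {r}))"
        using Suc.IH[of "T - {r}"] T fin k by auto
      then show "rank_sign r T * (A q r * (\<Sum>j\<in>T - {r}. \<Sum>l\<in>{l \<in> T - {r}. l < j}. ?h r j l))
          = rank_sign r T * (A q r * - (of_nat k * P k (T - {r})))" by simp
    qed
    also have "\<dots> = - (of_nat k * P (Suc k) S)"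
      unfolding sumS sum_distrib_left sum_negf[symmetric]
      by (intro sum.cong) (auto simp: mult_of_nat_commute mult.assoc)
    finally show ?thesis .
  qed
  have "(\<Sum>j\<in>S. \<Sum>l\<in>{l \<in> S. l < j}. ?g j l)
      = (\<Sum>l\<in>{l \<in> S. l < q}. ?g q l) + (\<Sum>j\<in>T. \<Sum>l\<in>{l \<in> S. l < j}. ?g j l)"
    using sum.remove[OF fin(1) q(1)] unfolding T_def by blast
  then show ?case unfolding top rest by (simp add: algebra_simps)
qed

lemma sum_bracket_set_pf:
  assumes S: "S \<subseteq> I" "card S = 2 * k" and p: "p \<in> I"
    and below: "\<And>s. s \<in> S \<Longrightarrow> s < p"
  shows "(\<Sum>j\<in>S. A p j * (A p j * P k S - P k S * A p j)) = - (of_nat k * P k S)"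
proof (cases k)
  case 0
  then show ?thesis using S finite_sub[of S] by simp
next
  case k: (Suc k')
  have fin: "finite S" using S(1) by (rule finite_sub)
  let ?g = "\<lambda>j l. rank_sign j S * rank_sign l (S - {j}) * (A p j * (A p l * P k' (S - {j} - {l})))"
  have "(\<Sum>j\<in>S. A p j * (A p j * P k S - P k S * A p j)) = (\<Sum>j\<in>S. - (\<Sum>l\<in>S - {j}. ?g j l))"
  proof (intro sum.cong refl)
    fix j assume j: "j \<in> S"
    have "P k (insert p (S - {j})) = (\<Sum>l\<in>S - {j}. rank_sign l (S - {j}) * (A p l * P k' (S - {j} - {l})))"
      unfolding k using fin below by (intro set_pf_insert) auto
    then show "A p j * (A p j * P k S - P k S * A p j) = - (\<Sum>l\<in>S - {j}. ?g j l)"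
      using bracket_set_pf[OF S p j below]
      by (simp add: sum_distrib_left rank_sign_left_commute mult.assoc)
  qed
  also have "\<dots> = - (\<Sum>j\<in>S. \<Sum>l\<in>S - {j}. ?g j l)" by (simp add: sum_negf)
  \<comment> \<open>The signs are antisymmetric in \<open>j\<close> and \<open>l\<close>, so that \<open>A p j * A p l\<close> may be replaced by the
    bracket \<open>- A j l\<close>.\<close>
  also have "(\<Sum>j\<in>S. \<Sum>l\<in>S - {j}. ?g j l)
      = (\<Sum>j\<in>S. (\<Sum>l\<in>{l \<in> S. l < j}. ?g j l) + (\<Sum>l\<in>{l \<in> S. j < l}. ?g j l))"
  proof (intro sum.cong refl)
    fix j assume "j \<in> S"
    have "S - {j} = {l \<in> S. l < j} \<union> {l \<in> S. j < l}" by auto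
    then show "(\<Sum>l\<in>S - {j}. ?g j l)
        = (\<Sum>l\<in>{l \<in> S. l < j}. ?g j l) + (\<Sum>l\<in>{l \<in> S. j < l}. ?g j l)"
      using sum.union_disjoint[of "{l \<in> S. l < j}" "{l \<in> S. j < l}"] fin by force
  qed
  \<comment> \<open>Relabelling the half with j < l collects both orders of a pair in one
    term.\<close>
  also have "\<dots> = (\<Sum>j\<in>S. \<Sum>l\<in>{l \<in> S. l < j}. ?g j l + ?g l j)"
    using sum.swap_restrict[OF fin fin, of ?g "(<)"] by (simp add: sum.distrib)
  also have "\<dots> = (\<Sum>j\<in>S. \<Sum>l\<in>{l \<in> S. l < j}.
      - (rank_sign j S * rank_sign l S * (A j l * P (k - 1) (S - {j} - {l}))))"
  proof (intro sum.cong refl)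
    fix j l assume j: "j \<in> S" and "l \<in> {l \<in> S. l < j}"
    then have l: "l \<in> S" "l < j" by auto
    then have "j \<in> I" "l \<in> I" using S(1) j by auto
    then have "A j p * A p l - A p l * A j p = A j l"
      using p l below[of l] below[of j] j by (intro bracket) auto
    moreover have "A p j = - A j p" using \<open>j \<in> I\<close> p by (rule skew)
    ultimately have 1: "A j l = - (A p j * A p l - A p l * A p j)" by simp
    have "S - {l} - {j} = S - {j} - {l}" by auto
    moreover have "rank_sign l S * rank_sign j (S - {l}) = - (rank_sign j S * rank_sign l S :: 'a)"
      using fin l rank_sign_commute[of "rank_sign l S :: 'a" j S] by (simp add: rank_sign_remove_less)
    ultimately show "?g j l + ?g l j = - (rank_sign j S * rank_sign l S * (A j l * P (k - 1) (S - {j} - {l})))"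
      using l unfolding 1 k by (simp add: rank_sign_remove_ge algebra_simps)
  qed
  also have "\<dots> = of_nat k * P k S"
    using pair_expansion[OF S] by (simp add: sum_negf)
  finally show ?thesis .
qed

text \<open>By \<open>bracket_set_pf\<close>, the expansion along q is A q p P(S) minus the sum of A
  q l [A p l, P(S)]. The extra summand A p l in the last factor contributes a sum equal to - k P(S),
  which \<open>- of_nat k\<close> offsets. The element z, later sqrt(-1), only ever multiplies from
  the left.\<close>

lemma two_row_reduction:
  assumes S: "S \<subseteq> I" "card S = 2 * k" and pq: "p \<in> I" "q \<in> I" "p < q"
    and below: "\<And>s. s \<in> S \<Longrightarrow> s < p"
  shows "z * P (Suc k) (insert q (insert p S))
    = (z * A q p - of_nat k) * P k S
      - (\<Sum>l\<in>S. (A p l + z * A q l) * (A p l * P k S - P k S * A p l))"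
proof -
  have fin: "finite S" "p \<notin> S" using S(1) finite_sub below by auto
  have "P (Suc k) (insert q (insert p S))
      = (\<Sum>l\<in>insert p S. rank_sign l (insert p S) * (A q l * P k (insert p S - {l})))"
    using fin pq below by (intro set_pf_insert) (auto dest: below)
  also have "\<dots> = A q p * P k S + (\<Sum>l\<in>S. rank_sign l S * (A q l * P k (insert p S - {l})))"
    using fin S(2) below
    by (simp add: rank_sign_insert_ge rank_sign_above less_imp_le cong: sum.cong)
  also have "(\<Sum>l\<in>S. rank_sign l S * (A q l * P k (insert p S - {l})))
      = (\<Sum>l\<in>S. - (A q l * (A p l * P k S - P k S * A p l)))"
  proof (intro sum.cong refl)
    fix l assume l: "l \<in> S"
    then have "insert p S - {l} = insert p (S - {l})" using fin by auto
    then show "rank_sign l S * (A q l * P k (insert p S - {l}))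
        = - (A q l * (A p l * P k S - P k S * A p l))"
      using bracket_set_pf[OF S pq(1) l below] by (simp add: rank_sign_left_commute)
  qed
  finally have "P (Suc k) (insert q (insert p S))
      = A q p * P k S - (\<Sum>l\<in>S. A q l * (A p l * P k S - P k S * A p l))"
    by (simp add: sum_negf)
  moreover have "(\<Sum>l\<in>S. (A p l + z * A q l) * (A p l * P k S - P k S * A p l))
      = (\<Sum>l\<in>S. A p l * (A p l * P k S - P k S * A p l))
        + z * (\<Sum>l\<in>S. A q l * (A p l * P k S - P k S * A p l))"
    by (simp only: distrib_right sum.distrib sum_distrib_left mult.assoc)
  moreover note sum_bracket_set_pf[OF S pq(1) below]
  ultimately show ?thesis
    by (simp only: left_diff_distrib[of "z * _" "of_nat _"] right_diff_distrib[of z] mult.assoc)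
      simp
qed

end

section \<open>Computing in a ring with carrier by means of type classes\<close>

text \<open>
  Families \<open>f\<close> with \<open>f R \<in> carrier R\<close> for every ring \<open>R\<close> on a given type form a type of class
  \<^class>\<open>ring_1\<close>, and every ring \<open>R\<close> is one of its components. The additional integer component
  ensures \<open>0 \<noteq> 1\<close> even if all rings on the type are trivial.
\<close>

typedef ('a, 'b) ring_family =
  "{x :: int \<times> (('a, 'b) ring_scheme \<Rightarrow> 'a).
    \<forall>R. if ring R then snd x R \<in> carrier R else snd x R = undefined}"
  by (rule exI[of _ "(0, \<lambda>R. if ring R then \<zero>\<^bsub>R\<^esub> else undefined)"]) (simp add: ring.ring_simprules)

setup_lifting type_definition_ring_family

lift_definition component :: "('a, 'b) ring_scheme \<Rightarrow> ('a, 'b) ring_family \<Rightarrow> 'a"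
  is "\<lambda>R x. snd x R" .

lift_definition int_component :: "('a, 'b) ring_family \<Rightarrow> int"
  is fst .

text \<open>Components at structures that are not rings are pinned to \<open>undefined\<close>, so
  they cannot distinguish two families.\<close>

lemma ring_family_eqI:
  assumes "int_component x = int_component y" "\<And>R. ring R \<Longrightarrow> component R x = component R y"
  shows "x = y"
  using assms by transfer (intro prod_eqI ext; metis)

lemma component_closed: "ring R \<Longrightarrow> component R x \<in> carrier R"
  by transfer auto

instantiation ring_family :: (type, type) "{zero, one, plus, times, uminus, minus}"
begin

lift_definition zero_ring_family :: "('a, 'b) ring_family"
  is "(0, \<lambda>R. if ring R then \<zero>\<^bsub>R\<^esub> else undefined)"
  by (simp add: ring.ring_simprules)

lift_definition one_ring_family :: "('a, 'b) ring_family"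
  is "(1, \<lambda>R. if ring R then \<one>\<^bsub>R\<^esub> else undefined)"
  by (simp add: ring.ring_simprules)

lift_definition plus_ring_family ::
    "('a, 'b) ring_family \<Rightarrow> ('a, 'b) ring_family \<Rightarrow> ('a, 'b) ring_family"
  is "\<lambda>x y. (fst x + fst y, \<lambda>R. if ring R then snd x R \<oplus>\<^bsub>R\<^esub> snd y R else undefined)"
  by (simp add: ring.ring_simprules)

lift_definition times_ring_family ::
    "('a, 'b) ring_family \<Rightarrow> ('a, 'b) ring_family \<Rightarrow> ('a, 'b) ring_family"
  is "\<lambda>x y. (fst x * fst y, \<lambda>R. if ring R then snd x R \<otimes>\<^bsub>R\<^esub> snd y R else undefined)"
  by (simp add: ring.ring_simprules)

lift_definition uminus_ring_family :: "('a, 'b) ring_family \<Rightarrow> ('a, 'b) ring_family"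
  is "\<lambda>x. (- fst x, \<lambda>R. if ring R then \<ominus>\<^bsub>R\<^esub> snd x R else undefined)"
  by (simp add: ring.ring_simprules)

lift_definition minus_ring_family ::
    "('a, 'b) ring_family \<Rightarrow> ('a, 'b) ring_family \<Rightarrow> ('a, 'b) ring_family"
  is "\<lambda>x y. (fst x - fst y, \<lambda>R. if ring R then snd x R \<ominus>\<^bsub>R\<^esub> snd y R else undefined)"
  by (simp add: ring.ring_simprules)

instance ..

end

lemma int_component_simps [simp]:
  "int_component 0 = 0" "int_component 1 = 1"
  "int_component (x + y) = int_component x + int_component y"
  "int_component (x * y) = int_component x * int_component y"
  "int_component (- x) = - int_component x"
  "int_component (x - y) = int_component x - int_component y"
  by (transfer; simp)+

lemma component_simps:
  assumes "ring R"
  shows "component R 0 = \<zero>\<^bsub>R\<^esub>" "component R 1 = \<one>\<^bsub>R\<^esub>"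
    "component R (x + y) = component R x \<oplus>\<^bsub>R\<^esub> component R y"
    "component R (x * y) = component R x \<otimes>\<^bsub>R\<^esub> component R y"
    "component R (- x) = \<ominus>\<^bsub>R\<^esub> component R x"
    "component R (x - y) = component R x \<ominus>\<^bsub>R\<^esub> component R y"
  using assms by (transfer; simp)+

instance ring_family :: (type, type) ring_1
proof
  fix x y z :: "('a, 'b) ring_family"
  note [simp] = component_simps component_closed
  show "x + y + z = x + (y + z)"
    by (rule ring_family_eqI) (simp_all add: ring.ring_simprules(7))
  show "x + y = y + x"
    by (rule ring_family_eqI) (simp_all add: ring.ring_simprules(10))
  show "0 + x = x"
    by (rule ring_family_eqI) (simp_all add: ring.ring_simprules(8))
  show "- x + x = 0"
    by (rule ring_family_eqI) (simp_all add: ring.ring_simprules(9))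
  show "x - y = x + - y"
    by (rule ring_family_eqI) (simp_all add: a_minus_def)
  show "x * y * z = x * (y * z)"
    by (rule ring_family_eqI) (simp_all add: ring.ring_simprules(11))
  show "1 * x = x"
    by (rule ring_family_eqI) (simp_all add: ring.ring_simprules(12))
  show "x * 1 = x"
    by (rule ring_family_eqI) (simp_all add: monoid.r_one[OF ring.is_monoid])
  show "(x + y) * z = x * z + y * z"
    by (rule ring_family_eqI) (simp_all add: ring.ring_simprules(13) distrib_right)
  show "x * (y + z) = x * y + x * z"
    by (rule ring_family_eqI) (simp_all add: ring.ring_simprules(23) distrib_left)
  have "int_component (0 :: ('a, 'b) ring_family) \<noteq> int_component 1" by simp
  then show "(0 :: ('a, 'b) ring_family) \<noteq> 1" by metis
qed

text \<open>Extension by zero respects sums and products but not the unit. The relations of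
  \<open>skew_generators\<close> do not mention the unit, so they hold in the whole product as soon
  as they hold in R.\<close>

lift_definition family_embed :: "('a, 'b) ring_scheme \<Rightarrow> 'a \<Rightarrow> ('a, 'b) ring_family"
  is "\<lambda>R a. (0, \<lambda>S. if \<not> ring S then undefined else if S = R \<and> a \<in> carrier R then a else \<zero>\<^bsub>S\<^esub>)"
  by (auto simp: ring.ring_simprules)

lemma int_component_family_embed: "int_component (family_embed R a) = 0"
  by transfer simp

context ring
begin

declare component_closed [OF ring_axioms, simp, intro] component_simps [OF ring_axioms, simp]

lemma component_family_embed:
  "ring S \<Longrightarrow> a \<in> carrier R \<Longrightarrow> component S (family_embed R a) = (if S = R then a else \<zero>\<^bsub>S\<^esub>)"
  by transfer simp

lemma component_sum [simp]: "component R (sum f B) = (\<Oplus>b\<in>B. component R (f b))"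
proof (induction B rule: infinite_finite_induct)
  case (insert b B)
  then show ?case by (subst finsum_insert) auto
qed (simp_all add: finsum_infinite)

lemma family_embed_uminus:
  "a \<in> carrier R \<Longrightarrow> - family_embed R a = family_embed R (\<ominus> a)"
  by (auto intro!: ring_family_eqI simp: int_component_family_embed component_simps
      component_family_embed ring.minus_zero)

lemma family_embed_hom:
  assumes "a \<in> carrier R" "b \<in> carrier R"
  shows "family_embed R a * family_embed R b = family_embed R (a \<otimes> b)"
    "family_embed R a - family_embed R b = family_embed R (a \<ominus> b)"
  using assms
  by (auto intro!: ring_family_eqI simp: int_component_family_embed component_simps
      component_family_embed a_minus_def ring.ring_simprules(2,8) ring.minus_zero ring.ring_simprules(24))

end

section \<open>The enveloping algebra\<close>

lemma ring_free_algebra: "ring (free_algebra S)"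
proof (rule ringI)
  show "abelian_group (free_algebra S)"
  proof (rule abelian_groupI)
    fix p assume "p \<in> carrier (free_algebra S)"
    then show "\<exists>q\<in>carrier (free_algebra S). q \<oplus>\<^bsub>free_algebra S\<^esub> p = \<zero>\<^bsub>free_algebra S\<^esub>"
      by (intro bexI[of _ "- p"]) (auto simp: free_algebra_def)
  qed (use keys_add in \<open>fastforce simp: free_algebra_def algebra_simps\<close>)+
  show "monoid (free_algebra S)"
  proof (rule monoidI)
    fix p q assume "p \<in> carrier (free_algebra S)" "q \<in> carrier (free_algebra S)"
    then show "p \<otimes>\<^bsub>free_algebra S\<^esub> q \<in> carrier (free_algebra S)"
      using keys_mult[of p q] by (fastforce simp: free_algebra_def plus_word_def)
  qed (auto simp: free_algebra_def mult.assoc zero_word_def)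
qed (auto simp: free_algebra_def algebra_simps)

text \<open>Subtraction in the record is derived from additive inverses in the carrier; their
  uniqueness identifies it with \<open>-\<close> on polynomial mappings.\<close>

lemma free_algebra_a_minus:
  assumes "p \<in> carrier (free_algebra S)" "q \<in> carrier (free_algebra S)"
  shows "p \<ominus>\<^bsub>free_algebra S\<^esub> q = p - q"
proof -
  interpret ring "free_algebra S" by (rule ring_free_algebra)
  have "- q \<in> carrier (free_algebra S)" using assms(2) by (simp add: free_algebra_def)
  then have "\<ominus>\<^bsub>free_algebra S\<^esub> q = - q"
    using assms(2) by (intro minus_equality) (auto simp: free_algebra_def)
  then show ?thesis by (simp add: a_minus_def) (simp add: free_algebra_def)
qed

lemma letter_closed: "x \<in> S \<Longrightarrow> letter x \<in> carrier (free_algebra S)"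
  by (simp add: free_algebra_def letter_def)

lemma scalar_closed: "scalar c \<in> carrier (free_algebra S)"
  by (simp add: free_algebra_def scalar_def zero_word_def)

text \<open>The ring axioms do not see the added field for scalar multiplication, but the extended
  record is a different structure and the axioms have to be carried over.\<close>

lemma ring_extend:
  assumes "ring R"
  shows "ring (ring.extend R r)"
proof -
  interpret R: ring R by fact
  have "\<exists>y\<in>carrier R. y \<oplus>\<^bsub>R\<^esub> x = \<zero>\<^bsub>R\<^esub>" if "x \<in> carrier R" for x
    using that R.l_neg by blast
  then show ?thesis
    by (intro ringI abelian_groupI monoidI)
      (auto simp: ring.defs R.a_assoc R.m_assoc R.l_distr R.r_distr R.a_comm R.a_lcomm)
qed

locale matrix_lie_algebra =
  fixes L :: "complex mat set"
  assumes add_closed: "x \<in> L \<Longrightarrow> y \<in> L \<Longrightarrow> x + y \<in> L"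
    and smult_closed: "x \<in> L \<Longrightarrow> c \<cdot>\<^sub>m x \<in> L"
    and bracket_closed: "x \<in> L \<Longrightarrow> y \<in> L \<Longrightarrow> x * y - y * x \<in> L"
begin

abbreviation (input) F where "F \<equiv> free_algebra L"
abbreviation (input) U where "U \<equiv> enveloping_algebra L"

definition cls where "cls p = lie_ideal L +>\<^bsub>F\<^esub> p"

sublocale F: ring F by (rule ring_free_algebra)

lemma F_closed:
  assumes "p \<in> carrier F" "q \<in> carrier F"
  shows "p + q \<in> carrier F" "p * q \<in> carrier F" "p - q \<in> carrier F"
  using F.a_closed[OF assms] F.m_closed[OF assms] F.minus_closed[OF assms]
    free_algebra_a_minus[OF assms]
  by (simp_all add: free_algebra_def)

lemma relators_closed: "lie_relators L \<subseteq> carrier F"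
  unfolding lie_relators_def
  using add_closed smult_closed bracket_closed
  by (auto intro!: F_closed letter_closed scalar_closed)

lemma ideal_lie_ideal: "ideal (lie_ideal L) F"
  unfolding lie_ideal_def by (rule F.genideal_ideal[OF relators_closed])

sublocale U: ring U
  unfolding enveloping_algebra_def
  by (intro ring_extend ideal.quotient_is_ring ideal_lie_ideal)

sublocale cls: ring_hom_ring F U cls
proof (rule ring_hom_ringI2)
  have "(\<lambda>p. lie_ideal L +>\<^bsub>F\<^esub> p) \<in> Ring.ring_hom F (F Quot lie_ideal L)"
    by (rule ideal.rcos_ring_hom[OF ideal_lie_ideal])
  then show "cls \<in> Ring.ring_hom F U"
    unfolding cls_def Ring.ring_hom_def enveloping_algebra_def by (simp add: ring.defs)
qed unfold_locales

lemma smult_eq: "c \<odot>\<^bsub>U\<^esub> X = cls (scalar c) \<otimes>\<^bsub>U\<^esub> X"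
  by (simp add: enveloping_algebra_def cls_def ring.defs module.defs)

lemma cls_simps:
  assumes "p \<in> carrier F" "q \<in> carrier F"
  shows "cls (p + q) = cls p \<oplus>\<^bsub>U\<^esub> cls q" "cls (p * q) = cls p \<otimes>\<^bsub>U\<^esub> cls q"
    "cls (p - q) = cls p \<ominus>\<^bsub>U\<^esub> cls q"
proof -
  show "cls (p + q) = cls p \<oplus>\<^bsub>U\<^esub> cls q" "cls (p * q) = cls p \<otimes>\<^bsub>U\<^esub> cls q"
    using cls.hom_add[OF assms] cls.hom_mult[OF assms] by (simp_all add: free_algebra_def)
  have "cls (p \<ominus>\<^bsub>F\<^esub> q) = cls p \<ominus>\<^bsub>U\<^esub> cls q" using assms by (simp add: a_minus_def)
  then show "cls (p - q) = cls p \<ominus>\<^bsub>U\<^esub> cls q"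
    using free_algebra_a_minus[OF assms] by simp
qed

lemma cls_0: "cls 0 = \<zero>\<^bsub>U\<^esub>" and cls_1: "cls 1 = \<one>\<^bsub>U\<^esub>"
  using cls.hom_zero cls.hom_one by (simp_all add: free_algebra_def)

lemma cls_scalar_closed [simp]: "cls (scalar c) \<in> carrier U"
  by (simp add: scalar_closed)

lemma cls_scalar_simps:
  "cls (scalar 0) = \<zero>\<^bsub>U\<^esub>" "cls (scalar 1) = \<one>\<^bsub>U\<^esub>"
  "cls (scalar (c + d)) = cls (scalar c) \<oplus>\<^bsub>U\<^esub> cls (scalar d)"
proof -
  have "scalar 0 = (0 :: 'z word \<Rightarrow>\<^sub>0 complex)" "scalar 1 = (1 :: 'z word \<Rightarrow>\<^sub>0 complex)"
      "scalar (c + d) = (scalar c + scalar d :: 'z word \<Rightarrow>\<^sub>0 complex)"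
    by (simp_all add: scalar_def single_add)
  then show "cls (scalar 0) = \<zero>\<^bsub>U\<^esub>" "cls (scalar 1) = \<one>\<^bsub>U\<^esub>"
    "cls (scalar (c + d)) = cls (scalar c) \<oplus>\<^bsub>U\<^esub> cls (scalar d)"
    by (simp_all add: scalar_def cls_0 cls_1 single_add)
       (metis cls_simps(1) scalar_closed scalar_def)
qed

text \<open>The signs in \<open>Pf\<close> are complex scalars, those in \<open>set_pf\<close> are
  ring elements; this connects the two.\<close>

lemma smult_power_minus_one:
  assumes "X \<in> carrier U"
  shows "(- 1) ^ e \<odot>\<^bsub>U\<^esub> X = (if even e then X else \<ominus>\<^bsub>U\<^esub> X)"
proof -
  have "cls (scalar (- 1)) \<oplus>\<^bsub>U\<^esub> \<one>\<^bsub>U\<^esub> = \<zero>\<^bsub>U\<^esub>"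
    using cls_scalar_simps(3)[of "- 1" 1] by (simp add: cls_scalar_simps)
  then have "cls (scalar (- 1)) = \<ominus>\<^bsub>U\<^esub> \<one>\<^bsub>U\<^esub>"
    by (metis U.minus_equality U.one_closed cls_scalar_closed)
  then show ?thesis
    using assms by (simp add: smult_eq minus_one_power_iff cls_scalar_simps U.l_minus)
qed

lemma cls_eq_if_relator:
  assumes "p - q \<in> lie_relators L" "p \<in> carrier F" "q \<in> carrier F"
  shows "cls p = cls q"
proof -
  have "p - q \<in> lie_ideal L"
    using assms(1) F.genideal_self[OF relators_closed] unfolding lie_ideal_def by blast
  then have "cls (p - q) = \<zero>\<^bsub>U\<^esub>"
    using ideal.Icarr[OF ideal_lie_ideal] additive_subgroup.a_subgroup[OF ideal.axioms(1)[OF ideal_lie_ideal]]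
    by (simp add: cls_def enveloping_algebra_def ring.defs FactRing_def F.a_coset_join2)
  then have "cls p \<ominus>\<^bsub>U\<^esub> cls q = \<zero>\<^bsub>U\<^esub>" using assms(2,3) by (simp add: cls_simps)
  then show ?thesis using assms(2,3) by simp
qed

lemma env_closed [simp]: "x \<in> L \<Longrightarrow> env L x \<in> carrier U"
  using cls.hom_closed[OF letter_closed[of x L]] by (simp add: env_def cls_def)

lemma env_eq_cls: "env L x = cls (letter x)"
  by (simp add: env_def cls_def)

lemma env_smult:
  assumes "x \<in> L"
  shows "env L (c \<cdot>\<^sub>m x) = c \<odot>\<^bsub>U\<^esub> env L x"
proof -
  have "letter (c \<cdot>\<^sub>m x) - scalar c * letter x \<in> lie_relators L"
    using assms unfolding lie_relators_def by blast
  then have "cls (letter (c \<cdot>\<^sub>m x)) = cls (scalar c * letter x)"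
    using assms by (intro cls_eq_if_relator F_closed letter_closed scalar_closed smult_closed)
  then show ?thesis
    using assms by (simp add: env_eq_cls smult_eq cls_simps letter_closed scalar_closed)
qed

lemma env_bracket:
  assumes "x \<in> L" "y \<in> L"
  shows "env L x \<otimes>\<^bsub>U\<^esub> env L y \<ominus>\<^bsub>U\<^esub> env L y \<otimes>\<^bsub>U\<^esub> env L x = env L (x * y - y * x)"
proof -
  have "letter x * letter y - letter y * letter x - letter (x * y - y * x) \<in> lie_relators L"
    using assms unfolding lie_relators_def by blast
  then have "cls (letter x * letter y - letter y * letter x) = cls (letter (x * y - y * x))"
    using assms by (intro cls_eq_if_relator F_closed letter_closed bracket_closed)
  then show ?thesis
    using assms by (simp add: env_eq_cls cls_simps letter_closed F_closed)
qed

lemma env_uminus: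
  assumes "x \<in> L"
  shows "env L (- 1 \<cdot>\<^sub>m x) = \<ominus>\<^bsub>U\<^esub> env L x"
  using assms smult_power_minus_one[of "env L x" 1] by (simp add: env_smult)

text \<open>The zero matrix is written as a multiple of x so that the scalar relators alone show
  that its class vanishes.\<close>

lemma env_commute:
  assumes "x \<in> L" "y \<in> L" "x * y - y * x = 0 \<cdot>\<^sub>m x"
  shows "env L x \<otimes>\<^bsub>U\<^esub> env L y = env L y \<otimes>\<^bsub>U\<^esub> env L x"
proof -
  have "env L x \<otimes>\<^bsub>U\<^esub> env L y \<ominus>\<^bsub>U\<^esub> env L y \<otimes>\<^bsub>U\<^esub> env L x = \<zero>\<^bsub>U\<^esub>"
    using assms by (simp add: env_bracket env_smult smult_eq cls_scalar_simps)
  then show ?thesis using assms by simp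
qed

lemma component_of_nat: "component U (of_nat k) = cls (scalar (of_nat k))"
  by (induction k) (simp_all add: cls_scalar_simps)

lemma component_rank_sign_mult:
  "component U (rank_sign l S * x) = (- 1) ^ card {s \<in> S. s < l} \<odot>\<^bsub>U\<^esub> component U x"
  unfolding smult_power_minus_one[OF component_closed[OF U.ring_axioms]]
  by (simp add: rank_sign_def minus_one_power_iff U.l_minus)

end

section \<open>Matrix units and the relations between the skew-symmetric generators\<close>

lemma mat_unit_carrier [simp]: "mat_unit n i j \<in> carrier_mat n n"
  by (simp add: mat_unit_def)

lemma mat_unit_mult:
  assumes "j \<in> {1..n}" "k \<in> {1..n}"
  shows "mat_unit n i j * mat_unit n k l = (if j = k then mat_unit n i l else 0\<^sub>m n n)"
proof (rule eq_matI)
  fix r c assume "r < dim_row (if j = k then mat_unit n i l else 0\<^sub>m n n)"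
    and "c < dim_col (if j = k then mat_unit n i l else 0\<^sub>m n n)"
  then have rc: "r < n" "c < n" by (auto simp: mat_unit_def split: if_splits)
  have "(mat_unit n i j * mat_unit n k l) $$ (r, c)
      = (\<Sum>t = 0..<n. (if Suc r = i \<and> Suc t = j then 1 else 0) * (if Suc t = k \<and> Suc c = l then 1 else 0))"
    using rc by (simp add: mat_unit_def scalar_prod_def)
  \<comment> \<open>The summation index counts from 0 and the matrix units from 1, so only t = j - 1
    can contribute.\<close>
  also have "\<dots> = (\<Sum>t = 0..<n. if t = j - 1 then
      (if Suc r = i \<and> j = k \<and> Suc c = l then 1 else 0) else 0)"
    using assms by (intro sum.cong) auto
  also have "\<dots> = (if j = k then mat_unit n i l else 0\<^sub>m n n) $$ (r, c)"
    using assms rc by (auto simp: mat_unit_def)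
  finally show "(mat_unit n i j * mat_unit n k l) $$ (r, c)
      = (if j = k then mat_unit n i l else 0\<^sub>m n n) $$ (r, c)" .
qed (auto simp: mat_unit_def)

lemma so_algebraI: "x \<in> carrier_mat n n \<Longrightarrow> transpose_mat x = - x \<Longrightarrow> x \<in> so_algebra n"
  unfolding so_algebra_def by blast

lemma mat_unit_dim [simp]: "dim_row (mat_unit n i j) = n" "dim_col (mat_unit n i j) = n"
  by (simp_all add: mat_unit_def)

lemma skew_unit_dim [simp]: "dim_row (skew_unit n a b) = n" "dim_col (skew_unit n a b) = n"
  by (simp_all add: skew_unit_def)

lemma skew_unit_index:
  "r < n \<Longrightarrow> c < n \<Longrightarrow> skew_unit n a b $$ (r, c) =
    (if Suc r = a \<and> Suc c = b then 1 else 0) - (if Suc r = b \<and> Suc c = a then 1 else 0)"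
  by (simp add: skew_unit_def mat_unit_def)

lemma skew_unit_in_so: "skew_unit n a b \<in> so_algebra n"
proof -
  have "transpose_mat (skew_unit n a b) = - skew_unit n a b"
  proof (rule eq_matI)
    fix r c
    assume "r < dim_row (- skew_unit n a b)" "c < dim_col (- skew_unit n a b)"
    then show "transpose_mat (skew_unit n a b) $$ (r, c) = (- skew_unit n a b) $$ (r, c)"
      by (simp only: index_transpose_mat index_uminus_mat skew_unit_dim skew_unit_index
          minus_diff_eq) (simp only: conj_commute)
  qed simp_all
  with _ show ?thesis by (rule so_algebraI) (simp add: carrier_matI)
qed

lemma skew_unit_swap: "skew_unit n b a = - 1 \<cdot>\<^sub>m skew_unit n a b"
  by (rule eq_matI)
    (simp_all only: index_smult_mat skew_unit_dim skew_unit_index mult_minus_left mult_1_left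
      minus_diff_eq)

lemma skew_unit_mult:
  "skew_unit n a b * skew_unit n c d
    = (mat_unit n a b * mat_unit n c d - mat_unit n a b * mat_unit n d c)
      - (mat_unit n b a * mat_unit n c d - mat_unit n b a * mat_unit n d c)"
proof -
  have minus: "mat_unit n i j - mat_unit n k l \<in> carrier_mat n n" for i j k l
    by (intro minus_carrier_mat mat_unit_carrier)
  show ?thesis
    unfolding skew_unit_def minus_mult_distrib_mat[OF mat_unit_carrier mat_unit_carrier minus]
      mult_minus_distrib_mat[OF mat_unit_carrier mat_unit_carrier mat_unit_carrier] ..
qed

lemma skew_unit_bracket:
  assumes "{a, b, c} \<subseteq> {1..n}" "a \<noteq> b" "b \<noteq> c" "a \<noteq> c"
  shows "skew_unit n a b * skew_unit n b c - skew_unit n b c * skew_unit n a b = skew_unit n a c"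
proof -
  have "skew_unit n a b * skew_unit n b c = (mat_unit n a c - 0\<^sub>m n n) - (0\<^sub>m n n - 0\<^sub>m n n)"
    "skew_unit n b c * skew_unit n a b = (0\<^sub>m n n - 0\<^sub>m n n) - (0\<^sub>m n n - mat_unit n c a)"
    using assms by (simp_all add: skew_unit_mult mat_unit_mult)
  then show ?thesis unfolding skew_unit_def[of n a c] by (intro eq_matI) simp_all
qed

lemma skew_unit_commute:
  assumes "{a, b, c, d} \<subseteq> {1..n}" "a \<notin> {c, d}" "b \<notin> {c, d}"
  shows "skew_unit n a b * skew_unit n c d - skew_unit n c d * skew_unit n a b = 0 \<cdot>\<^sub>m skew_unit n a b"
proof -
  have "skew_unit n a b * skew_unit n c d = (0\<^sub>m n n - 0\<^sub>m n n) - (0\<^sub>m n n - 0\<^sub>m n n)"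
    "skew_unit n c d * skew_unit n a b = (0\<^sub>m n n - 0\<^sub>m n n) - (0\<^sub>m n n - 0\<^sub>m n n)"
    using assms by (simp_all add: skew_unit_mult mat_unit_mult)
  then show ?thesis by (intro eq_matI) simp_all
qed

interpretation so: matrix_lie_algebra "so_algebra n" for n
proof
  fix x y :: "complex mat" and c
  assume x: "x \<in> so_algebra n" and y: "y \<in> so_algebra n"
  then have d: "x \<in> carrier_mat n n" "y \<in> carrier_mat n n"
    "transpose_mat x = - x" "transpose_mat y = - y" unfolding so_algebra_def by blast+
  have "transpose_mat (x + y) = - (x + y)"
    unfolding transpose_add[OF d(1,2)] d(3,4) using d(1,2) by (intro eq_matI) auto
  with _ show "x + y \<in> so_algebra n" by (rule so_algebraI) (use d(1,2) in simp)
  have "transpose_mat (c \<cdot>\<^sub>m x) = c \<cdot>\<^sub>m transpose_mat x"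
    using d(1) by (intro eq_matI) auto
  also have "\<dots> = - (c \<cdot>\<^sub>m x)"
    unfolding d(3) using d(1) by (intro eq_matI) auto
  finally have "transpose_mat (c \<cdot>\<^sub>m x) = - (c \<cdot>\<^sub>m x)" .
  with _ show "c \<cdot>\<^sub>m x \<in> so_algebra n" by (rule so_algebraI) (use d(1) in simp)
  have "transpose_mat (x * y) = y * x" "transpose_mat (y * x) = x * y"
    unfolding transpose_mult[OF d(1,2)] transpose_mult[OF d(2,1)] d(3,4)
    using d(1,2) by simp_all
  then have "transpose_mat (x * y - y * x) = y * x - x * y"
    using transpose_minus[of "x * y" n n "y * x"] d(1,2) by simp
  also have "\<dots> = - (x * y - y * x)"
    using d(1,2) by (intro eq_matI) auto
  finally have "transpose_mat (x * y - y * x) = - (x * y - y * x)" .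
  with _ show "x * y - y * x \<in> so_algebra n"
    by (rule so_algebraI) (intro minus_carrier_mat mult_carrier_mat[OF d(2,1)])
qed

section \<open>Comparison of the recursion over sequences with the one over sets\<close>

definition so_family where
  "so_family n a b = family_embed (enveloping_algebra (so_algebra n)) (so_gen n a b)"

lemma so_gen_closed [simp]: "so_gen n a b \<in> carrier (enveloping_algebra (so_algebra n))"
  by (simp add: so_gen_def skew_unit_in_so)

lemma component_so_family [simp]:
  "component (enveloping_algebra (so_algebra n)) (so_family n a b) = so_gen n a b"
  by (simp add: so_family_def so.U.component_family_embed so.U.ring_axioms)

interpretation so: skew_generators "so_family n" "{1..n}" for n
proof
  fix a b c d
  show "so_family n b a = - so_family n a b"
    by (simp add: so_family_def so.U.family_embed_uminus so_gen_def skew_unit_swap[of n b a]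
        so.env_uminus skew_unit_in_so)
  show "so_family n a b * so_family n c d = so_family n c d * so_family n a b"
    if "{a, b, c, d} \<subseteq> {1..n}" "a \<notin> {c, d}" "b \<notin> {c, d}"
    using so.env_commute[OF skew_unit_in_so skew_unit_in_so skew_unit_commute[OF that]]
    by (simp add: so_family_def so.U.family_embed_hom so_gen_def skew_unit_in_so)
  show "so_family n a b * so_family n b c - so_family n b c * so_family n a b = so_family n a c"
    if "a \<in> {1..n}" "b \<in> {1..n}" "c \<in> {1..n}" "a \<noteq> b" "b \<noteq> c" "a \<noteq> c"
    using so.env_bracket[OF skew_unit_in_so skew_unit_in_so, of n a b b c] skew_unit_bracket[of a b c n] that
    by (simp add: so_family_def so.U.family_embed_hom so_gen_def skew_unit_in_so)
qed simp

text \<open>Injectivity makes leaving out a position the same as removing a value. Of N positions, N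
  - 1 remain, namely \<open>{1..<N}\<close>.\<close>

lemma image_omit:
  assumes "strict_mono_on {1..Suc N} i" "j \<in> {1..N}"
  shows "omit j i ` {1..<N} = i ` {1..N} - {i j}"
proof -
  have inj: "inj_on i {1..Suc N}" using assms(1) by (rule strict_mono_on_imp_inj_on)
  have "omit j i ` {1..<N} = i ` (\<lambda>r. if r < j then r else Suc r) ` {1..<N}"
    by (force simp: omit_def image_image)
  also have "(\<lambda>r. if r < j then r else Suc r) ` {1..<N} = {1..N} - {j}"
  proof (intro equalityI subsetI)
    fix r assume "r \<in> {1..N} - {j}"
    then show "r \<in> (\<lambda>r. if r < j then r else Suc r) ` {1..<N}"
      using assms(2) by (intro image_eqI[of _ _ "if r < j then r else r - 1"]) auto
  qed (use assms(2) in \<open>auto split: if_splits\<close>)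
  also have "i ` ({1..N} - {j}) = i ` {1..N} - {i j}"
    using inj_on_image_set_diff[OF inj, of "{1..N}" "{j}"] assms(2)
    by (simp add: subset_iff)
  finally show ?thesis .
qed

text \<open>For an increasing sequence the last entry is the maximum of the index set, and omitting
  an entry keeps the sequence increasing. Hence both recursions run in parallel.\<close>

lemma Pf_eq_component:
  assumes "strict_mono_on {1..2 * k} i"
  shows "Pf n k i = component (enveloping_algebra (so_algebra n)) (set_pf (so_family n) k (i ` {1..2 * k}))"
  using assms
proof (induction n k i rule: Pf.induct)
  case (1 n i)
  then show ?case by simp
next
  case (2 n i)
  then have "i 1 < i 2" by (auto simp: strict_mono_on_def)
  moreover have "i ` {1..2 * Suc 0} = insert (i 2) {i 1}"
    by (auto simp: image_iff le_Suc_eq numeral_2_eq_2)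
  moreover have "set_pf (so_family n) (Suc 0) (insert (i 2) {i 1}) = so_family n (i 2) (i 1)"
    using \<open>i 1 < i 2\<close> by (subst set_pf_insert) (auto simp: rank_sign_insert_ge, simp add: rank_sign_def)
  ultimately show ?case by simp
next
  case (3 n k i)
  \<comment> \<open>N is the number of indices below the top one; after an omission N - 1 = 2 * Suc
    k of them are left.\<close>
  define K N where "K = Suc (Suc k)" and "N = 2 * K - 1"
  have N: "2 * K = Suc N" "{1..2 * Suc k} = {1..<N}" by (auto simp: K_def N_def)
  have mono: "i r < i s" if "r \<in> {1..Suc N}" "s \<in> {1..Suc N}" "r < s" for r s
    using 3(2) that unfolding K_def[symmetric] N(1) by (auto simp: strict_mono_on_def)
  have inj: "inj_on i {1..N}"
    using 3(2) unfolding K_def[symmetric] N(1)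
    by (meson strict_mono_on_imp_inj_on inj_on_subset atLeastatMost_subset_iff le_SucI order_refl)
  let ?U = "enveloping_algebra (so_algebra n)"
  let ?S = "i ` {1..N}"
  let ?t = "\<lambda>l. rank_sign l ?S * (so_family n (i (2 * K)) l * set_pf (so_family n) (Suc k) (?S - {l}))"
  have "i ` {1..2 * K} = insert (i (2 * K)) ?S"
    unfolding N(1) by (simp add: atLeastAtMostSuc_conv)
  moreover have "set_pf (so_family n) K (insert (i (2 * K)) ?S) = sum ?t ?S"
    unfolding K_def by (rule set_pf_insert) (auto intro!: mono simp: N(1) simp flip: K_def)
  ultimately have "set_pf (so_family n) K (i ` {1..2 * K}) = (\<Sum>j\<in>{1..N}. ?t (i j))"
    by (simp only: sum.reindex[OF inj] o_def)
  then have "component ?U (set_pf (so_family n) K (i ` {1..2 * K}))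
      = (\<Oplus>\<^bsub>?U\<^esub>j\<in>{1..N}. component ?U (?t (i j)))"
    by simp
  also have "\<dots> = (\<Oplus>\<^bsub>?U\<^esub>j\<in>{1..N}. (- 1) ^ (j + 1) \<odot>\<^bsub>?U\<^esub>
      (so_gen n (i (2 * K)) (i j) \<otimes>\<^bsub>?U\<^esub> Pf n (Suc k) (omit j i)))"
  proof (rule so.U.finsum_cong'[OF refl, symmetric])
    fix j assume j: "j \<in> {1..N}"
    \<comment> \<open>The entries below i j are those at the first j - 1 positions, and j - 1 has
      the parity of j + 1.\<close>
    have "{s \<in> ?S. s < i j} = i ` {1..<j}"
    proof (intro equalityI subsetI)
      fix s assume "s \<in> {s \<in> ?S. s < i j}"
      then obtain r where r: "s = i r" "r \<in> {1..N}" "i r < i j" by auto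
      then have "r < j"
        using mono[of j r] j by (cases r j rule: linorder_cases) auto
      then show "s \<in> i ` {1..<j}" using r by auto
    qed (use j mono in auto)
    moreover have "inj_on i {1..<j}" using j by (intro inj_on_subset[OF inj]) auto
    ultimately have "card {s \<in> ?S. s < i j} = j - 1" by (simp add: card_image)
    then have sign: "(- 1) ^ card {s \<in> ?S. s < i j} = ((- 1) ^ (j + 1) :: complex)"
      using j by (cases j) auto
    have "strict_mono_on {1..2 * Suc k} (omit j i)"
      unfolding N(2) using j by (auto simp: strict_mono_on_def omit_def intro!: mono)
    then have "Pf n (Suc k) (omit j i)
        = component ?U (set_pf (so_family n) (Suc k) (omit j i ` {1..2 * Suc k}))"
      by (rule 3(1)[OF refl refl])
    moreover have "omit j i ` {1..2 * Suc k} = ?S - {i j}"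
      unfolding N(2) using 3(2) j by (intro image_omit) (simp_all flip: K_def N(1))
    ultimately show "(- 1) ^ (j + 1) \<odot>\<^bsub>?U\<^esub>
        (so_gen n (i (2 * K)) (i j) \<otimes>\<^bsub>?U\<^esub> Pf n (Suc k) (omit j i)) = component ?U (?t (i j))"
      unfolding so.component_rank_sign_mult sign
      by (simp only: component_simps[OF so.U.ring_axioms] component_so_family)
  qed simp
  also have "\<dots> = Pf n K i" unfolding N_def K_def by (simp only: Pf.simps(3) Let_def)
  finally show ?case unfolding K_def by (rule sym)
qed

theorem proposition5p2:
  fixes m :: nat and U (structure)
  assumes "m \<ge> 2"
  defines "U \<equiv> enveloping_algebra (so_algebra (2 * m))"
  defines "A \<equiv> so_gen (2 * m)"
  defines "H \<equiv> \<i> \<odot> A (2 * m) (2 * m - 1)"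
  defines "X \<equiv> \<lambda>i. A (2 * m - 1) i \<oplus> \<i> \<odot> A (2 * m) i"
  shows "\<i> \<odot> PF (2 * m) m =
    (H \<ominus> of_nat m \<odot> \<one> \<oplus> \<one>) \<otimes> PF (2 * m) (m - 1)
      \<ominus> (\<Oplus>i \<in> {1..2 * m - 2}. X i \<otimes> commutator U (A (2 * m - 1) i) (PF (2 * m) (m - 1)))"
proof -
  interpret U: ring U unfolding U_def by (rule so.U.ring_axioms)
  obtain k where m: "m = Suc k" using assms(1) by (cases m) auto
  define P where "P = set_pf (so_family (2 * m))"
  \<comment> \<open>Multiplication by the scalar sqrt(-1) is multiplication by its class in U, so
    this class can play the part of z.\<close>
  define z where "z = family_embed U (so.cls (2 * m) (scalar \<i>))"
  have smult: "\<i> \<odot> x = component U z \<otimes> x" for x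
    unfolding z_def U_def by (simp add: so.U.component_family_embed so.U.ring_axioms so.smult_eq)
  have A: "component U (so_family (2 * m) a b) = A a b" for a b
    by (simp add: U_def A_def)
  have PF: "PF (2 * m) l = component U (P l {1..2 * l})" for l
    unfolding PF_def U_def P_def by (subst Pf_eq_component) (auto simp: strict_mono_on_def)
  have H: "H \<in> carrier U"
    by (simp add: H_def A_def U_def so.smult_eq)
  \<comment> \<open>Since m = k + 1, the shift - m + 1 of the claim is the - k of the
    reduction.\<close>
  have "of_nat m \<odot> \<one> = component U (of_nat k) \<oplus> \<one>"
    unfolding m U_def using so.cls_scalar_simps[of "2 * Suc k"] 
    by (simp add: so.smult_eq so.component_of_nat so.U.a_comm)
  then have shift: "H \<ominus> of_nat m \<odot> \<one> \<oplus> \<one> = H \<ominus> component U (of_nat k)"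
    using H by (simp add: a_minus_def U.minus_add U.a_assoc U.l_neg)
  \<comment> \<open>The two top rows are p = 2m - 1 and q = 2m, above the set of the remaining 2k =
    2m - 2 indices. This identity in the product of rings is then projected to its component
    U.\<close>
  have "z * P (Suc k) (insert (2 * m) (insert (2 * m - 1) {1..2 * k}))
    = (z * so_family (2 * m) (2 * m) (2 * m - 1) - of_nat k) * P k {1..2 * k}
      - (\<Sum>l\<in>{1..2 * k}. (so_family (2 * m) (2 * m - 1) l + z * so_family (2 * m) (2 * m) l)
          * (so_family (2 * m) (2 * m - 1) l * P k {1..2 * k}
            - P k {1..2 * k} * so_family (2 * m) (2 * m - 1) l))"
    unfolding P_def using m by (intro so.two_row_reduction) auto
  moreover have "insert (2 * m) (insert (2 * m - 1) {1..2 * k}) = {1..2 * m}"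
    using m by auto
  ultimately have "component U (z * P m {1..2 * m}) = component U
      ((z * so_family (2 * m) (2 * m) (2 * m - 1) - of_nat k) * P k {1..2 * k}
      - (\<Sum>l\<in>{1..2 * k}. (so_family (2 * m) (2 * m - 1) l + z * so_family (2 * m) (2 * m) l)
          * (so_family (2 * m) (2 * m - 1) l * P k {1..2 * k}
            - P k {1..2 * k} * so_family (2 * m) (2 * m - 1) l)))"
    using m by simp
  moreover have "2 * m - 2 = 2 * k" "m - 1 = k" using m by auto
  ultimately show ?thesis
    unfolding shift
    by (simp only: component_simps[OF U.ring_axioms] U.component_sum smult A commutator_def X_def H_def flip: PF)
qed

end
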